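(* Let $(a_n)_{n\ge0}$ be the sequence, listed in increasing order, of the non-negative integers $m$ such that $240m+169$ is a perfect square. Then $$\sum_{n=0}^\infty(-1)^{\lfloor 5n/4\rfloor}q^{a_n}=\frac{(q^3,q^5,q^8;q^8)_\infty\,(q^2,q^{14};q^{16})_\infty}{(q^2,q^3;q^5)_\infty}.$$
   Context: Here $q$ is a complex number with $|q|<1$ (equivalently, the identity may be read as an identity of formal power series in $q$). For a complex number $a$, $(a;q)_\infty:=\prod_{i=0}^\infty(1-aq^i)$, and $(a_1,a_2,\dots,a_m;q)_\infty:=\prod_{j=1}^m(a_j;q)_\infty$. $\lfloor x\rfloor$ is the floor function. *)

theory Defs
  imports "HOL-Analysis.Analysis" "HOL-Library.Infinite_Set"
begin

definition qpoch_inf :: "complex \<Rightarrow> complex \<Rightarrow> complex" where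
  "qpoch_inf a q = (\<Prod>i. 1 - a * q ^ i)"

definition qpochs_inf :: "complex list \<Rightarrow> complex \<Rightarrow> complex" where
  "qpochs_inf as q = prod_list (map (\<lambda>a. qpoch_inf a q) as)"

definition square_idx :: "nat set" where
  "square_idx = {m. \<exists>k::nat. 240 * m + 169 = k ^ 2}"

definition a_seq :: "nat \<Rightarrow> nat" where
  "a_seq n = enumerate square_idx n"

text \<open>
  The next two facts show that the total functions above are not evaluated at junk values:
  the index set is infinite, as \<^const>\<open>enumerate\<close> requires, and the products converge.
\<close>

lemma infinite_square_idx: "infinite square_idx"
proof -
  have "inj (\<lambda>j::nat. 13 * j + 60 * j ^ 2)"
    by (rule strict_mono_imp_inj_on) (auto simp: strict_mono_def intro!: add_less_le_mono power_mono)
  moreover have "range (\<lambda>j::nat. 13 * j + 60 * j ^ 2) \<subseteq> square_idx"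
  proof (rule image_subsetI)
    fix j :: nat
    have "240 * (13 * j + 60 * j ^ 2) + 169 = (13 + 120 * j) ^ 2"
      by (simp add: power2_eq_square algebra_simps)
    then show "13 * j + 60 * j ^ 2 \<in> square_idx"
      unfolding square_idx_def by blast
  qed
  ultimately show ?thesis
    using finite_subset range_inj_infinite by blast
qed

lemma strict_mono_a_seq: "strict_mono a_seq"
  using strict_mono_enumerate[OF infinite_square_idx] by (simp add: strict_mono_def a_seq_def)

lemma range_a_seq: "range a_seq = square_idx"
  using range_enumerate[OF infinite_square_idx] by (simp add: a_seq_def)

lemma convergent_prod_qpoch:
  fixes a q :: complex
  assumes "norm q < 1"
  shows "convergent_prod (\<lambda>i. 1 - a * q ^ i)"
proof -
  have "summable (\<lambda>i. norm ((1 - a * q ^ i) - 1))"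
    using assms by (simp add: norm_mult norm_power summable_mult)
  then show ?thesis
    by (intro abs_convergent_prod_imp_convergent_prod summable_imp_abs_convergent_prod)
qed

end

theory Submission imports Defs begin

text \<open>
  Put \<open>q = x\<^sup>2\<close> and \<open>H(q) = 1 / (q\<^sup>2, q\<^sup>3; q\<^sup>5)\<^sub>\<infinity>\<close>. Rearranging factors gives
  \<open>(x\<^sup>2, x\<^sup>3, x\<^sup>5; x\<^sup>5)\<^sub>\<infinity> (x, x\<^sup>9; x\<^sup>1\<^sup>0)\<^sub>\<infinity> = (x; x)\<^sub>\<infinity> H(x\<^sup>2)\<close>. As \<open>H(x\<^sup>2)\<close> is even in \<open>x\<close>, the odd
  part of the left side is \<open>H(q)\<close> times the odd part of \<open>(x; x)\<^sub>\<infinity>\<close>. The quintuple product identity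
  expands the left side into terms \<open>\<plusminus>x\<^sup>e\<close> with \<open>120 e + 49 = (10 r + 7)\<^sup>2\<close>; for \<open>e = 2 m + 1\<close> this says
  \<open>240 m + 169 = (10 r + 7)\<^sup>2\<close>, so its odd part is \<open>-x\<close> times the sum of the \<open>\<plusminus>q\<^sup>m\<close> in question. The
  pentagonal number theorem expands \<open>(x; x)\<^sub>\<infinity>\<close> into terms \<open>\<plusminus>x\<^sup>p\<close> with \<open>24 p + 1 = (6 n + 1)\<^sup>2\<close>; those
  with \<open>p = 2 e + 1\<close> satisfy \<open>48 e + 25 = (8 r + 5)\<^sup>2\<close>, and by the quintuple product identity in base
  \<open>q\<^sup>8\<close> they add up to \<open>-x (q\<^sup>3, q\<^sup>5, q\<^sup>8; q\<^sup>8)\<^sub>\<infinity> (q\<^sup>2, q\<^sup>1\<^sup>4; q\<^sup>1\<^sup>6)\<^sub>\<infinity>\<close>.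
\<close>

section \<open>Finite q-Pochhammer symbols and Gaussian binomials\<close>

definition qpoch :: "'a::comm_ring_1 \<Rightarrow> 'a \<Rightarrow> nat \<Rightarrow> 'a" where
  "qpoch a q n = (\<Prod>k<n. 1 - a * q ^ k)"

lemma qpoch_0 [simp]: "qpoch a q 0 = 1"
  by (simp add: qpoch_def)

lemma qpoch_Suc: "qpoch a q (Suc n) = qpoch a q n * (1 - a * q ^ n)"
  by (simp add: qpoch_def)

lemma qpoch_Suc_shift: "qpoch a q (Suc n) = (1 - a) * qpoch (a * q) q n"
  by (simp only: qpoch_def prod.lessThan_Suc_shift) (simp add: mult.assoc)

lemma qpoch_add: "qpoch a q (m + n) = qpoch a q m * qpoch (a * q ^ m) q n"
  by (induction n) (simp_all add: qpoch_Suc power_add mult_ac)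

lemma qpoch_mult: "qpoch a q (n * k) = (\<Prod>j<k. qpoch (a * q ^ j) (q ^ k) n)"
proof (induction n)
  case (Suc n)
  have "qpoch a q (Suc n * k) = qpoch a q (n * k) * qpoch (a * q ^ (n * k)) q k"
    by (simp add: add.commute[of k] qpoch_add)
  also have "qpoch (a * q ^ (n * k)) q k = (\<Prod>j<k. 1 - a * q ^ j * (q ^ k) ^ n)"
    by (simp add: qpoch_def mult_ac flip: power_mult)
  finally show ?case
    by (simp add: Suc.IH qpoch_Suc prod.distrib)
qed simp

lemma Suc_choose_two: "Suc n choose 2 = n + (n choose 2)"
  by (simp add: numeral_2_eq_2)

lemma qpoch_reverse:
  fixes z q :: "'a::field"
  assumes "z \<noteq> 0" "q \<noteq> 0"
  shows "qpoch (z / q ^ n) q n = (- z) ^ n / q ^ (Suc n choose 2) * qpoch (q / z) q n"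
proof (induction n)
  case (Suc n)
  have "qpoch (z / q ^ Suc n) q (Suc n) = (1 - z / q ^ Suc n) * qpoch (z / q ^ n) q n"
    using assms by (simp add: qpoch_Suc_shift)
  also have "1 - z / q ^ Suc n = - z / q ^ Suc n * (1 - q / z * q ^ n)"
    using assms by (simp add: field_simps)
  finally show ?case
    by (simp add: Suc.IH qpoch_Suc[of "q / z"] Suc_choose_two[of "Suc n"] power_add mult_ac)
qed (simp add: numeral_2_eq_2)

fun qbinom :: "'a::comm_ring_1 \<Rightarrow> nat \<Rightarrow> nat \<Rightarrow> 'a" where
  "qbinom q n 0 = 1"
| "qbinom q 0 (Suc k) = 0"
| "qbinom q (Suc n) (Suc k) = qbinom q n k + q ^ Suc k * qbinom q n (Suc k)"

lemma qbinom_eq_0: "n < k \<Longrightarrow> qbinom q n k = 0"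
  by (induction q n k rule: qbinom.induct) auto

theorem qbinom_theorem:
  "qpoch z q n = (\<Sum>k\<le>n. q ^ (k choose 2) * qbinom q n k * (- z) ^ k)"
proof (induction n arbitrary: z)
  case (Suc n)
  let ?t = "\<lambda>k. q ^ (k choose 2) * qbinom q n k * (- (z * q)) ^ k"
  have Suc_term: "q ^ (Suc k choose 2) * qbinom q (Suc n) (Suc k) * (- z) ^ Suc k
      = ?t (Suc k) + (- z) * ?t k" for k
  proof -
    have "(- (z * q)) ^ k = (- z) ^ k * q ^ k" for k
      by (simp flip: power_mult_distrib)
    then show ?thesis
      by (simp add: Suc_choose_two power_add algebra_simps)
  qed
  have "qpoch z q (Suc n) = (\<Sum>k\<le>n. ?t k) + (\<Sum>k\<le>n. (- z) * ?t k)"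
    by (simp add: qpoch_Suc_shift Suc.IH left_diff_distrib sum_negf flip: sum_distrib_left)
  also have "(\<Sum>k\<le>n. ?t k) = (\<Sum>k\<le>Suc n. ?t k)"
    by (simp add: qbinom_eq_0)
  also have "\<dots> = 1 + (\<Sum>k\<le>n. ?t (Suc k))"
    by (simp only: sum.atMost_Suc_shift) (simp add: numeral_2_eq_2)
  also have "\<dots> + (\<Sum>k\<le>n. (- z) * ?t k)
      = 1 + (\<Sum>k\<le>n. q ^ (Suc k choose 2) * qbinom q (Suc n) (Suc k) * (- z) ^ Suc k)"
    by (simp only: Suc_term sum.distrib add.assoc)
  also have "\<dots> = (\<Sum>k\<le>Suc n. q ^ (k choose 2) * qbinom q (Suc n) k * (- z) ^ k)"
    by (simp only: sum.atMost_Suc_shift) (simp add: numeral_2_eq_2)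
  finally show ?case .
qed (simp add: numeral_2_eq_2)

lemma qbinom_mult_qpoch:
  "qbinom q (m + n) m * qpoch q q m * qpoch q q n = qpoch q q (m + n)"
proof (induction m arbitrary: n)
  case (Suc m)
  note outer = Suc.IH
  show ?case
  proof (induction n)
    case 0
    then show ?case
      using outer[of 0] by (simp add: qbinom_eq_0 qpoch_Suc flip: mult.assoc)
  next
    case (Suc n)
    let ?m = "Suc m" and ?n = "Suc n"
    have "qbinom q (?m + ?n) ?m * qpoch q q ?m * qpoch q q ?n
      = (1 - q ^ ?m) * (qbinom q (m + ?n) m * qpoch q q m * qpoch q q ?n)
        + q ^ ?m * (1 - q ^ ?n) * (qbinom q (?m + n) ?m * qpoch q q ?m * qpoch q q n)"
      by (simp add: qpoch_Suc algebra_simps)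
    also have "\<dots> = ((1 - q ^ ?m) + q ^ ?m * (1 - q ^ ?n)) * qpoch q q (m + ?n)"
      unfolding outer Suc.IH by (simp add: algebra_simps)
    also have "(1 - q ^ ?m) + q ^ ?m * (1 - q ^ ?n) = 1 - q ^ (?m + ?n)"
      by (simp add: algebra_simps power_add)
    finally show ?case
      by (simp add: qpoch_Suc mult.commute)
  qed
qed simp

definition binom2 :: "int \<Rightarrow> int" where
  "binom2 n = n * (n - 1) div 2"

lemma two_mult_binom2: "2 * binom2 n = n * (n - 1)"
  by (simp add: binom2_def)

lemma binom2_of_nat: "binom2 (int n) = int (n choose 2)"
  by (cases n) (simp_all add: binom2_def choose_two zdiv_int algebra_simps)

definition central_qbinom :: "'a::comm_ring_1 \<Rightarrow> nat \<Rightarrow> int \<Rightarrow> 'a" where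
  "central_qbinom q N n = (if \<bar>n\<bar> \<le> int N then qbinom q (2 * N) (nat (int N + n)) else 0)"

theorem finite_jacobi_triple_product:
  fixes q z :: "'a::field"
  assumes "q \<noteq> 0" "z \<noteq> 0"
  shows "qpoch z q N * qpoch (q / z) q N = (\<Sum>n\<in>{- int N..int N}.
    q powi binom2 n * (- z) powi n * central_qbinom q N n)"
proof -
  let ?C = "(- z) ^ N / q ^ (Suc N choose 2)"
  let ?t = "\<lambda>n. q powi binom2 n * (- z) powi n"
  have shifted_term: "q ^ (k choose 2) * (- (z / q ^ N)) ^ k = ?C * ?t (int k - int N)" for k
  proof -
    let ?n = "int k - int N"
    have "int (k choose 2) - int (N * k) = binom2 ?n - int (Suc N choose 2)"
      using two_mult_binom2[of "int k"] two_mult_binom2[of ?n]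
        two_mult_binom2[of "int (Suc N)"]
      by (simp add: algebra_simps flip: binom2_of_nat)
    then have q_part: "q ^ (k choose 2) / q ^ (N * k) = q powi binom2 ?n / q ^ (Suc N choose 2)"
      using assms by (simp flip: power_int_of_nat power_int_diff)
    have z_part: "(- z) ^ k = (- z) ^ N * (- z) powi ?n"
      using assms by (simp flip: power_int_of_nat power_int_add)
    have "q ^ (k choose 2) * (- (z / q ^ N)) ^ k = q ^ (k choose 2) / q ^ (N * k) * (- z) ^ k"
      unfolding minus_divide_left power_divide power_mult by simp
    also have "\<dots> = ?C * ?t ?n"
      unfolding q_part z_part by simp
    finally show ?thesis .
  qed
  have "?C * (qpoch z q N * qpoch (q / z) q N) = qpoch (z / q ^ N) q (2 * N)"
    using assms by (simp add: mult_2[of N] qpoch_add qpoch_reverse)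
  also have "\<dots> = (\<Sum>k\<le>2 * N. q ^ (k choose 2) * (- (z / q ^ N)) ^ k * qbinom q (2 * N) k)"
    by (simp only: qbinom_theorem mult_ac)
  also have "\<dots> = (\<Sum>n\<in>{- int N..int N}. ?C * (?t n * central_qbinom q N n))"
    by (rule sum.reindex_bij_witness[of _ "\<lambda>n. nat (int N + n)" "\<lambda>k. int k - int N"])
       (auto simp: shifted_term central_qbinom_def mult.assoc)
  finally have "?C * (qpoch z q N * qpoch (q / z) q N)
    = ?C * (\<Sum>n\<in>{- int N..int N}. ?t n * central_qbinom q N n)"
    by (simp only: sum_distrib_left)
  then show ?thesis
    using assms by (subst (asm) mult_left_cancel) auto
qed

section \<open>Infinite products\<close>

lemma mult_power_neq_1:
  fixes a q :: "'a::real_normed_div_algebra"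
  assumes "norm q < 1" "norm a < 1"
  shows "a * q ^ n \<noteq> 1"
proof
  assume "a * q ^ n = 1"
  then have "norm a * norm q ^ n = 1"
    by (metis norm_mult norm_one norm_power)
  moreover have "norm a * norm q ^ n \<le> norm a * 1"
    using assms by (intro mult_left_mono power_le_one) auto
  ultimately show False
    using assms by simp
qed

lemma qpoch_nonzero:
  fixes a q :: "'a::real_normed_field"
  assumes "norm q < 1" "norm a < 1"
  shows "qpoch a q n \<noteq> 0"
  using mult_power_neq_1[OF assms] by (simp add: qpoch_def)

lemma qpoch_inf_nonzero:
  assumes "norm q < 1" "norm a < 1"
  shows "qpoch_inf a q \<noteq> 0"
  unfolding qpoch_inf_def using mult_power_neq_1[OF assms]
  by (intro prodinf_nonzero convergent_prod_qpoch assms) auto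

lemma qpoch_LIMSEQ:
  assumes "norm q < 1"
  shows "(\<lambda>n. qpoch a q n) \<longlonglongrightarrow> qpoch_inf a q"
  using convergent_prod_LIMSEQ[OF convergent_prod_qpoch[OF assms, of a]]
  unfolding qpoch_inf_def qpoch_def LIMSEQ_lessThan_iff_atMost[of "prod (\<lambda>i. 1 - a * q ^ i)"] .

lemma qpoch_inf_split:
  assumes "norm q < 1" "k > 0"
  shows "qpoch_inf a q = (\<Prod>j<k. qpoch_inf (a * q ^ j) (q ^ k))"
proof (rule LIMSEQ_unique)
  show "(\<lambda>n. qpoch a q (n * k)) \<longlonglongrightarrow> qpoch_inf a q"
    using assms by (intro filterlim_compose[OF qpoch_LIMSEQ] filterlim_subseq)
      (auto simp: strict_mono_def)
  show "(\<lambda>n. qpoch a q (n * k)) \<longlonglongrightarrow> (\<Prod>j<k. qpoch_inf (a * q ^ j) (q ^ k))"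
    unfolding qpoch_mult using assms
    by (intro tendsto_prod qpoch_LIMSEQ) (simp add: norm_power power_less_one_iff)
qed

lemma qbinom_eq_divide:
  fixes q :: "'a::real_normed_field"
  assumes "norm q < 1"
  shows "qbinom q (m + n) m = qpoch q q (m + n) / (qpoch q q m * qpoch q q n)"
  using qbinom_mult_qpoch[of q m n] qpoch_nonzero[OF assms assms]
  by (simp add: field_simps)

lemma qbinom_bounded:
  fixes q :: complex
  assumes "norm q < 1"
  obtains K where "\<And>n k. norm (qbinom q n k) \<le> K"
proof -
  let ?P = "qpoch q q"
  have limit: "?P \<longlonglongrightarrow> qpoch_inf q q" "qpoch_inf q q \<noteq> 0"
    by (simp_all add: qpoch_LIMSEQ qpoch_inf_nonzero assms)
  obtain B where B_bound: "B > 0" "\<And>n. norm (?P n) \<le> B"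
    using convergent_imp_Bseq[OF convergentI[OF limit(1)]] by (auto elim: BseqE)
  obtain B' where B'_bound: "B' > 0" "\<And>n. norm (inverse (?P n)) \<le> B'"
    using convergent_imp_Bseq[OF convergentI[OF tendsto_inverse[OF limit]]] by (auto elim: BseqE)
  have "norm (qbinom q n k) \<le> B * (B' * B')" for n k
  proof (cases "k \<le> n")
    case True
    then obtain d where "n = k + d"
      using le_Suc_ex by blast
    then show ?thesis
      unfolding \<open>n = k + d\<close> qbinom_eq_divide[OF assms] divide_inverse inverse_mult_distrib norm_mult
      using B_bound(1) B'_bound(1) by (intro mult_mono B_bound(2) B'_bound(2)) auto
  qed (use B_bound B'_bound in \<open>simp add: qbinom_eq_0\<close>)
  then show ?thesis by (rule that)
qed

lemma qbinom_tendsto: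
  fixes q :: complex
  assumes "norm q < 1" "filterlim a sequentially F" "filterlim b sequentially F"
  shows "((\<lambda>x. qbinom q (a x + b x) (a x)) \<longlongrightarrow> 1 / qpoch_inf q q) F"
proof -
  have "filterlim (\<lambda>x. a x + b x) sequentially F"
    by (rule filterlim_at_top_mono[OF assms(2)]) simp
  then have "((\<lambda>x. qpoch q q (a x + b x) / (qpoch q q (a x) * qpoch q q (b x)))
      \<longlongrightarrow> qpoch_inf q q / (qpoch_inf q q * qpoch_inf q q)) F"
    using assms by (intro tendsto_intros filterlim_compose[OF qpoch_LIMSEQ])
      (auto simp: qpoch_inf_nonzero)
  then show ?thesis
    by (simp add: qbinom_eq_divide qpoch_inf_nonzero assms)
qed

section \<open>Infinite sums\<close>

lemma infsum_dominated_convergence: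
  fixes f :: "nat \<Rightarrow> 'a \<Rightarrow> 'b::{banach, second_countable_topology}"
  assumes "g summable_on A"
    and lim: "\<And>x. x \<in> A \<Longrightarrow> (\<lambda>n. f n x) \<longlonglongrightarrow> h x"
    and bound: "\<And>n x. x \<in> A \<Longrightarrow> norm (f n x) \<le> g x"
  shows "(\<lambda>n. infsum (f n) A) \<longlonglongrightarrow> infsum h A"
proof -
  have integrable_iff: "integrable (count_space A) u \<longleftrightarrow> (\<lambda>x. norm (u x)) summable_on A"
    for u :: "'a \<Rightarrow> 'c::{banach, second_countable_topology}"
    using abs_summable_equivalent unfolding abs_summable_on_def by blast
  have integral_eq: "integral\<^sup>L (count_space A) u = infsum u A"
    if "integrable (count_space A) u" for u :: "'a \<Rightarrow> 'b"
    using that infsetsum_infsum unfolding infsetsum_def abs_summable_on_def by blast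
  have g_integrable: "integrable (count_space A) g"
    using assms(1) unfolding integrable_iff summable_on_iff_abs_summable_on_real[symmetric] .
  note dominated = g_integrable lim bound
  have "integrable (count_space A) h"
    by (rule integrable_dominated_convergence[where s = f and w = g])
       (use dominated in \<open>auto simp: AE_count_space\<close>)
  moreover have "integrable (count_space A) (f n)" for n
    by (rule Bochner_Integration.integrable_bound[OF g_integrable])
       (use bound order_trans[OF _ abs_ge_self] in \<open>auto simp: AE_count_space\<close>)
  moreover have "(\<lambda>n. integral\<^sup>L (count_space A) (f n)) \<longlonglongrightarrow> integral\<^sup>L (count_space A) h"
    by (rule integral_dominated_convergence[where w = g])
       (use dominated in \<open>auto simp: AE_count_space\<close>)
  ultimately show ?thesis
    by (simp add: integral_eq)
qed

lemma has_sum_Times_mult: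
  fixes f :: "'a \<Rightarrow> complex" and g :: "'b \<Rightarrow> complex"
  assumes "(f has_sum S) A" "(g has_sum T) B"
  shows "((\<lambda>(x, y). f x * g y) has_sum S * T) (A \<times> B)"
proof (rule has_sum_SigmaI)
  have abs: "(\<lambda>x. norm (f x)) summable_on A" "(\<lambda>y. norm (g y)) summable_on B"
    using assms has_sum_imp_summable summable_on_iff_abs_summable_on_complex by blast+
  have "(\<lambda>(x, y). norm (f x) * norm (g y)) summable_on A \<times> B"
    by (rule summable_on_SigmaI[where g = "\<lambda>x. norm (f x) * infsum (\<lambda>y. norm (g y)) B"])
       (use abs in \<open>auto intro!: has_sum_cmult_right summable_on_cmult_left\<close>)
  then show "(\<lambda>(x, y). f x * g y) summable_on A \<times> B"
    using abs_summable_summable[of "\<lambda>(x, y). f x * g y"] by (simp add: case_prod_unfold norm_mult)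
qed (use assms in \<open>auto intro: has_sum_cmult_right has_sum_cmult_left\<close>)

lemma has_sum_translate:
  fixes f :: "'a::group_add \<Rightarrow> 'b::{comm_monoid_add, topological_space}"
  shows "((\<lambda>x. f (x + a)) has_sum S) UNIV \<longleftrightarrow> (f has_sum S) UNIV"
  by (rule has_sum_reindex_bij_witness[of _ "\<lambda>x. x - a" "\<lambda>x. x + a"]) auto

lemma has_sum_reflect:
  fixes f :: "'a::ab_group_add \<Rightarrow> 'b::{comm_monoid_add, topological_space}"
  shows "((\<lambda>x. f (a - x)) has_sum S) UNIV \<longleftrightarrow> (f has_sum S) UNIV"
  by (rule has_sum_reindex_bij_witness[of _ "\<lambda>x. a - x" "\<lambda>x. a - x"]) auto

lemma summable_on_intI:
  fixes f :: "int \<Rightarrow>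
    'a::{uniform_topological_group_add, topological_comm_monoid_add, ab_group_add, complete_uniform_space}"
  assumes "(\<lambda>n. f (int n)) summable_on UNIV" "(\<lambda>n. f (- int n)) summable_on UNIV"
  shows "f summable_on UNIV"
proof -
  have "f summable_on range int" "f summable_on range (\<lambda>n. - int n)"
    using assms by (simp_all add: summable_on_reindex inj_on_def o_def)
  then have "f summable_on (range int \<union> range (\<lambda>n. - int n))"
    by (rule summable_on_union)
  also have "range int \<union> range (\<lambda>n. - int n) = UNIV"
    by (auto simp: image_iff) (metis int_cases2)
  finally show ?thesis .
qed

lemma has_sum_odd_part:
  fixes x :: "'b::real_normed_field" and e :: "'a \<Rightarrow> int"
  assumes "((\<lambda>n. c n * x powi e n) has_sum F) A" "((\<lambda>n. c n * (- x) powi e n) has_sum F') A"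
  shows "((\<lambda>n. c n * x powi e n) has_sum (F - F') / 2) {n \<in> A. odd (e n)}"
proof -
  have "((\<lambda>n. (c n * x powi e n - c n * (- x) powi e n) / 2) has_sum (F - F') / 2) A"
    using has_sum_divide_const[OF has_sum_add[OF assms(1) has_sum_uminusI[OF assms(2)]], of 2] by simp
  also have "?this \<longleftrightarrow> ((\<lambda>n. c n * x powi e n) has_sum (F - F') / 2) {n \<in> A. odd (e n)}"
    by (rule has_sum_cong_neutral) auto
  finally show ?thesis .
qed

section \<open>The Jacobi triple product\<close>

lemma binom2_minus: "binom2 (- n) = binom2 n + n"
  using two_mult_binom2[of n] two_mult_binom2[of "- n"] by (simp add: algebra_simps)

lemma summable_norm_power_choose_two:
  fixes q z :: "'a::real_normed_field"
  assumes "norm q < 1"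
  shows "summable (\<lambda>n. norm (q ^ (n choose 2) * z ^ n))"
proof -
  have "(\<lambda>n. norm (q ^ n * z)) \<longlonglongrightarrow> norm (0 * z)"
    using assms by (intro tendsto_intros LIMSEQ_power_zero)
  then have "eventually (\<lambda>n. norm (q ^ n * z) < 1/2) sequentially"
    by (rule order_tendstoD) simp
  then obtain N where small: "\<And>n. n \<ge> N \<Longrightarrow> norm (q ^ n * z) < 1/2"
    by (auto simp: eventually_sequentially)
  show ?thesis
  proof (rule summable_ratio_test[of "1/2" N])
    fix n assume "n \<ge> N"
    have "norm (q ^ (Suc n choose 2) * z ^ Suc n)
        = norm (q ^ n * z) * norm (q ^ (n choose 2) * z ^ n)"
      by (simp add: Suc_choose_two power_add norm_mult mult_ac)
    also have "\<dots> \<le> 1/2 * norm (q ^ (n choose 2) * z ^ n)"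
      using small[OF \<open>n \<ge> N\<close>] by (intro mult_right_mono) auto
    finally show "norm (norm (q ^ (Suc n choose 2) * z ^ Suc n))
        \<le> 1/2 * norm (norm (q ^ (n choose 2) * z ^ n))"
      by simp
  qed simp
qed

lemma summable_norm_power_binom2:
  fixes q z :: "'a::real_normed_field"
  assumes "norm q < 1" "q \<noteq> 0" "z \<noteq> 0"
  shows "(\<lambda>n. norm (q powi binom2 n * z powi n)) summable_on UNIV"
proof (rule summable_on_intI)
  show "(\<lambda>n. norm (q powi binom2 (int n) * z powi int n)) summable_on UNIV"
    using summable_norm_power_choose_two[OF assms(1), of z]
    by (intro summable_nonneg_imp_summable_on) (auto simp: binom2_of_nat)
  have "q powi binom2 (- int n) * z powi (- int n) = q ^ (n choose 2) * (q / z) ^ n" for n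
    using assms
    by (simp add: binom2_minus binom2_of_nat power_int_add power_int_minus power_divide field_simps)
  then show "(\<lambda>n. norm (q powi binom2 (- int n) * z powi (- int n))) summable_on UNIV"
    using summable_norm_power_choose_two[OF assms(1), of "q / z"]
    by (intro summable_nonneg_imp_summable_on) auto
qed

lemma central_qbinom_LIMSEQ:
  fixes q :: complex
  assumes "norm q < 1"
  shows "(\<lambda>N. central_qbinom q N n) \<longlonglongrightarrow> 1 / qpoch_inf q q"
proof -
  have "eventually (\<lambda>N. Z \<le> nat (int N + m)) sequentially" for Z m
    using eventually_ge_at_top[of "Z + nat \<bar>m\<bar>"] by eventually_elim auto
  then have "filterlim (\<lambda>N. nat (int N + m)) sequentially sequentially" for m
    by (simp add: filterlim_at_top)
  then have "(\<lambda>N. qbinom q (nat (int N + n) + nat (int N - n)) (nat (int N + n)))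
      \<longlonglongrightarrow> 1 / qpoch_inf q q"
    using assms by (intro qbinom_tendsto) (auto simp flip: add_uminus_conv_diff)
  moreover have "eventually (\<lambda>N. qbinom q (nat (int N + n) + nat (int N - n)) (nat (int N + n))
      = central_qbinom q N n) sequentially"
    using eventually_ge_at_top[of "nat \<bar>n\<bar>"]
  proof eventually_elim
    case (elim N)
    then have "nat (int N + n) + nat (int N - n) = 2 * N" by auto
    with elim show ?case by (simp add: central_qbinom_def)
  qed
  ultimately show ?thesis
    by (rule Lim_transform_eventually)
qed

lemma central_qbinom_bounded:
  fixes q :: complex
  assumes "norm q < 1"
  obtains K where "\<And>N n. norm (central_qbinom q N n) \<le> K"
proof -
  obtain K where "\<And>n k. norm (qbinom q n k) \<le> K"
    using qbinom_bounded[OF assms] by blast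
  moreover from this[of 0 0] have "0 \<le> K" by simp
  ultimately show ?thesis
    by (intro that[of K]) (simp add: central_qbinom_def)
qed

theorem jacobi_triple_product:
  fixes q z :: complex
  assumes q: "norm q < 1" "q \<noteq> 0" and z: "z \<noteq> 0"
  shows "((\<lambda>n. q powi binom2 n * (- z) powi n) has_sum
    qpoch_inf z q * qpoch_inf (q / z) q * qpoch_inf q q) UNIV"
proof -
  let ?t = "\<lambda>n. q powi binom2 n * (- z) powi n"
  let ?c = "central_qbinom q"
  obtain K where K_bound: "\<And>N n. norm (?c N n) \<le> K"
    using central_qbinom_bounded[OF q(1)] by blast
  have summable: "(\<lambda>n. norm (?t n)) summable_on UNIV"
    using q z by (intro summable_norm_power_binom2) auto
  have "(\<lambda>N. \<Sum>\<^sub>\<infinity>n. ?t n * ?c N n) \<longlonglongrightarrow> (\<Sum>\<^sub>\<infinity>n. ?t n * (1 / qpoch_inf q q))"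
  proof (rule infsum_dominated_convergence)
    show "(\<lambda>n. norm (?t n) * K) summable_on UNIV"
      using summable by (rule summable_on_cmult_left)
    show "norm (?t n * ?c N n) \<le> norm (?t n) * K" for N n
      unfolding norm_mult[of "?t n"] by (intro mult_left_mono K_bound) simp
  qed (intro tendsto_intros central_qbinom_LIMSEQ q)
  also have "(\<lambda>N. \<Sum>\<^sub>\<infinity>n. ?t n * ?c N n) = (\<lambda>N. qpoch z q N * qpoch (q / z) q N)"
  proof
    fix N
    have "(\<Sum>\<^sub>\<infinity>n. ?t n * ?c N n) = (\<Sum>\<^sub>\<infinity>n\<in>{- int N..int N}. ?t n * ?c N n)"
      by (rule infsum_cong_neutral) (auto simp: central_qbinom_def)
    then show "(\<Sum>\<^sub>\<infinity>n. ?t n * ?c N n) = qpoch z q N * qpoch (q / z) q N"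
      using q z by (simp add: finite_jacobi_triple_product)
  qed
  finally have "(\<Sum>\<^sub>\<infinity>n. ?t n * (1 / qpoch_inf q q)) = qpoch_inf z q * qpoch_inf (q / z) q"
    using tendsto_mult[OF qpoch_LIMSEQ[OF q(1)] qpoch_LIMSEQ[OF q(1)]] by (rule LIMSEQ_unique)
  then have "infsum ?t UNIV = qpoch_inf z q * qpoch_inf (q / z) q * qpoch_inf q q"
    using qpoch_inf_nonzero[OF q(1) q(1)] unfolding infsum_cmult_left' by (simp add: field_simps)
  then show ?thesis
    using abs_summable_summable[OF summable] has_sum_infsum by metis
qed

corollary jacobi_triple_product_square:
  fixes q z :: complex
  assumes "norm q < 1" "q \<noteq> 0" "z \<noteq> 0"
  shows "((\<lambda>n. q powi n\<^sup>2 * (- z) powi n) has_sum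
    qpoch_inf (q * z) (q\<^sup>2) * qpoch_inf (q / z) (q\<^sup>2) * qpoch_inf (q\<^sup>2) (q\<^sup>2)) UNIV"
proof -
  have "(q\<^sup>2) powi binom2 n * (- (q * z)) powi n = q powi n\<^sup>2 * (- z) powi n" for n
  proof -
    have "2 * binom2 n + n = n\<^sup>2"
      unfolding two_mult_binom2 by (simp add: power2_eq_square algebra_simps)
    then have "(q\<^sup>2) powi binom2 n * q powi n = q powi n\<^sup>2"
      using assms by (simp add: power_int_power flip: power_int_add)
    then show ?thesis
      unfolding mult_minus_right[symmetric] power_int_mult_distrib by simp
  qed
  moreover have "q\<^sup>2 / (q * z) = q / z"
    using assms by (simp add: power2_eq_square)
  ultimately show ?thesis
    using jacobi_triple_product[of "q\<^sup>2" "q * z"] assms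
    by (simp add: norm_power power_less_one_iff)
qed

definition pentagonal :: "int \<Rightarrow> int" where
  "pentagonal n = n * (3 * n + 1) div 2"

lemma two_mult_pentagonal: "2 * pentagonal n = n * (3 * n + 1)"
  by (simp add: pentagonal_def)

theorem pentagonal_number_theorem:
  fixes q :: complex
  assumes "norm q < 1" "q \<noteq> 0"
  shows "((\<lambda>n. (-1) powi n * q powi pentagonal n) has_sum qpoch_inf q q) UNIV"
proof -
  have "(q ^ 3) powi binom2 n * (- (q\<^sup>2)) powi n = (-1) powi n * q powi pentagonal n" for n
  proof -
    have "pentagonal n = 3 * binom2 n + 2 * n"
      using two_mult_binom2[of n] two_mult_pentagonal[of n] by (simp add: algebra_simps)
    then show ?thesis
      using assms by (simp add: power_int_power power_int_add power_int_minus_left)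
  qed
  moreover have "qpoch_inf q q
      = qpoch_inf (q\<^sup>2) (q ^ 3) * qpoch_inf (q ^ 3 / q\<^sup>2) (q ^ 3) * qpoch_inf (q ^ 3) (q ^ 3)"
    using assms by (subst qpoch_inf_split[of q 3])
      (auto simp: numeral_3_eq_3 power2_eq_square power3_eq_cube mult_ac)
  ultimately show ?thesis
    using jacobi_triple_product[of "q ^ 3" "q\<^sup>2"] assms
    by (simp add: norm_power power_less_one_iff)
qed

corollary pentagonal_number_theorem_square:
  fixes q :: complex
  assumes "norm q < 1" "q \<noteq> 0"
  shows "((\<lambda>m. (-1) powi m * q powi (3 * m\<^sup>2 + m)) has_sum qpoch_inf (q\<^sup>2) (q\<^sup>2)) UNIV"
proof -
  have "2 * pentagonal m = 3 * m\<^sup>2 + m" for m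
    unfolding two_mult_pentagonal by (simp add: power2_eq_square algebra_simps)
  then have "(q\<^sup>2) powi pentagonal m = q powi (3 * m\<^sup>2 + m)" for m
    by (simp only: power_int_power of_nat_numeral)
  then show ?thesis
    using pentagonal_number_theorem[of "q\<^sup>2"] assms
    by (simp add: norm_power power_less_one_iff)
qed

section \<open>The quintuple product\<close>

lemma mod_3_neq_2_cases:
  fixes r :: int
  assumes "r mod 3 \<noteq> 2"
  obtains s where "r = 3 * s" | s where "r = 3 * s + 1"
proof -
  have "r = 3 * (r div 3) \<or> r = 3 * (r div 3) + 1"
    using assms by presburger
  then show ?thesis using that by blast
qed

lemma six_mult_pred_div_six:
  fixes r :: int
  assumes "r mod 3 \<noteq> 2"
  shows "6 * (r * (r - 1) div 6) = r * (r - 1)"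
proof (rule dvd_mult_div_cancel)
  from assms have "3 dvd r \<or> 3 dvd r - 1"
    by presburger
  then have "3 dvd r * (r - 1)"
    by auto
  moreover have "even (r * (r - 1))"
    by simp
  ultimately have "2 * 3 dvd r * (r - 1)"
    by (intro divides_mult) auto
  then show "6 dvd r * (r - 1)"
    by simp
qed

text \<open>
  Up to the factor \<open>(q\<^sup>2; q\<^sup>2)\<^sub>\<infinity>\<close>, the quintuple product is the product of two Jacobi triple products,
  hence a double series in which the coefficient of \<open>z\<^sup>r\<close> is a monomial times the following theta
  series. By the pentagonal number theorem in base \<open>q\<^sup>2\<close>, the latter is zero or a monomial times
  \<open>(q\<^sup>2; q\<^sup>2)\<^sub>\<infinity>\<close>, depending on \<open>r\<close> modulo 3.
\<close>

definition quintuple_coeff :: "complex \<Rightarrow> int \<Rightarrow> complex" where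
  "quintuple_coeff q r = (\<Sum>\<^sub>\<infinity>m::int. (-1) powi m * q powi (3 * m\<^sup>2 - (2 * r - 1) * m))"

lemma has_sum_quintuple_coeff:
  assumes "norm q < 1" "q \<noteq> 0"
  shows "((\<lambda>m. (-1) powi m * q powi (3 * m\<^sup>2 - (2 * r - 1) * m)) has_sum quintuple_coeff q r) UNIV"
proof -
  have "(q ^ 3) powi m\<^sup>2 * (- (q powi (1 - 2 * r))) powi m
      = (-1) powi m * q powi (3 * m\<^sup>2 - (2 * r - 1) * m)" for m
  proof -
    have exponent: "3 * m\<^sup>2 - (2 * r - 1) * m = 3 * m\<^sup>2 + (1 - 2 * r) * m"
      by (simp add: algebra_simps)
    show ?thesis
      unfolding exponent using assms
      by (simp add: power_int_power power_int_add power_int_minus_left flip: power_int_mult)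
  qed
  then have "(\<lambda>m. (-1) powi m * q powi (3 * m\<^sup>2 - (2 * r - 1) * m)) summable_on UNIV"
    using jacobi_triple_product_square[of "q ^ 3" "q powi (1 - 2 * r)"] assms
    by (simp add: norm_power power_less_one_iff has_sum_imp_summable)
  then show ?thesis
    unfolding quintuple_coeff_def by (rule has_sum_infsum)
qed

lemma quintuple_coeff_0_mod_3:
  assumes q: "norm q < 1" "q \<noteq> 0"
  shows "quintuple_coeff q (3 * s) = (-1) powi s * q powi (s - 3 * s\<^sup>2) * qpoch_inf (q\<^sup>2) (q\<^sup>2)"
proof (rule has_sum_unique)
  let ?f = "\<lambda>m. (-1) powi m * q powi (3 * m\<^sup>2 - (2 * (3 * s) - 1) * m)"
  show "(?f has_sum quintuple_coeff q (3 * s)) UNIV"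
    by (rule has_sum_quintuple_coeff) fact+
  have "?f (m + s) = (-1) powi s * q powi (s - 3 * s\<^sup>2) * ((-1) powi m * q powi (3 * m\<^sup>2 + m))" for m
  proof -
    have "3 * (m + s)\<^sup>2 - (2 * (3 * s) - 1) * (m + s) = (s - 3 * s\<^sup>2) + (3 * m\<^sup>2 + m)"
      by (simp add: power2_eq_square algebra_simps)
    then show ?thesis
      using q by (simp add: power_int_add)
  qed
  then show "(?f has_sum (-1) powi s * q powi (s - 3 * s\<^sup>2) * qpoch_inf (q\<^sup>2) (q\<^sup>2)) UNIV"
    using has_sum_cmult_right[OF pentagonal_number_theorem_square[OF q]]
    by (subst has_sum_translate[of _ s, symmetric]) simp
qed

lemma quintuple_coeff_reflect: "quintuple_coeff q (1 - r) = quintuple_coeff q r"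
  unfolding quintuple_coeff_def
  by (rule infsum_reindex_bij_witness[of _ uminus uminus])
     (auto simp: power_int_minus_left algebra_simps)

lemma quintuple_coeff_1_mod_3:
  assumes "norm q < 1" "q \<noteq> 0"
  shows "quintuple_coeff q (3 * s + 1) = (-1) powi s * q powi (- s - 3 * s\<^sup>2) * qpoch_inf (q\<^sup>2) (q\<^sup>2)"
  using quintuple_coeff_0_mod_3[OF assms, of "- s"] quintuple_coeff_reflect[of q "3 * (- s)"]
  by (simp add: power_int_minus_one_minus add.commute)

lemma quintuple_coeff_eq_0:
  assumes q: "norm q < 1" "q \<noteq> 0" and "r mod 3 = 2"
  shows "quintuple_coeff q r = 0"
proof -
  define s where "s = r div 3"
  have r_eq: "r = 3 * s + 2"
    unfolding s_def using assms(3) by presburger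
  let ?f = "\<lambda>m. (-1) powi m * q powi (3 * m\<^sup>2 - (2 * r - 1) * m)"
  have coeff_sum: "(?f has_sum quintuple_coeff q r) UNIV"
    by (rule has_sum_quintuple_coeff) fact+
  have "?f (2 * s + 1 - m) = - ?f m" for m
  proof -
    have "3 * (2 * s + 1 - m)\<^sup>2 - (2 * r - 1) * (2 * s + 1 - m)
        = 3 * m\<^sup>2 - (2 * r - 1) * m"
      by (simp add: r_eq power2_eq_square algebra_simps)
    then show ?thesis
      by (simp add: power_int_minus_left)
  qed
  then have "(?f has_sum - quintuple_coeff q r) UNIV"
    using has_sum_uminusI[OF coeff_sum] by (subst has_sum_reflect[of _ "2 * s + 1", symmetric]) simp
  from has_sum_unique[OF this coeff_sum] show ?thesis
    by simp
qed

lemma quintuple_coeff_eq: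
  assumes "norm q < 1" "q \<noteq> 0" "r mod 3 \<noteq> 2"
  shows "quintuple_coeff q r =
    (-1) powi (r + r mod 3) * q powi (- 2 * (r * (r - 1) div 6)) * qpoch_inf (q\<^sup>2) (q\<^sup>2)"
proof -
  define e where "e = r * (r - 1) div 6"
  have six_e: "6 * e = r * (r - 1)"
    unfolding e_def using assms(3) by (rule six_mult_pred_div_six)
  from assms(3) show ?thesis
  proof (cases rule: mod_3_neq_2_cases)
    case (1 s)
    have exponent: "- 2 * e = s - 3 * s\<^sup>2"
      using six_e unfolding 1 by (simp add: power2_eq_square algebra_simps)
    show ?thesis
      unfolding e_def[symmetric] exponent unfolding 1 quintuple_coeff_0_mod_3[OF assms(1,2)]
      by (simp add: power_int_minus_left)
  next
    case (2 s)
    have exponent: "- 2 * e = - s - 3 * s\<^sup>2"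
      using six_e unfolding 2 by (simp add: power2_eq_square algebra_simps)
    show ?thesis
      unfolding e_def[symmetric] exponent unfolding 2 quintuple_coeff_1_mod_3[OF assms(1,2)]
      by (simp add: power_int_minus_left)
  qed
qed

lemma theta_product_diagonal:
  fixes q z :: complex
  assumes "q \<noteq> 0" "z \<noteq> 0"
  shows "q powi binom2 (r - 2 * m) * (- z) powi (r - 2 * m) * (q powi m\<^sup>2 * (- (z\<^sup>2)) powi m)
    = q powi binom2 r * (- z) powi r * ((-1) powi m * q powi (3 * m\<^sup>2 - (2 * r - 1) * m))"
proof -
  have exponent: "binom2 (r - 2 * m) + m\<^sup>2 = binom2 r + (3 * m\<^sup>2 - (2 * r - 1) * m)"
    using two_mult_binom2[of "r - 2 * m"] two_mult_binom2[of r]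
    by (simp add: power2_eq_square algebra_simps)
  have q_part: "q powi binom2 (r - 2 * m) * q powi m\<^sup>2
      = q powi binom2 r * q powi (3 * m\<^sup>2 - (2 * r - 1) * m)"
    using assms(1) by (simp only: power_int_add[symmetric] exponent simp_thms)
  have "(- (z\<^sup>2)) powi m = (-1) powi m * (- z) powi (2 * m)"
    by (simp add: power_int_mult power_int_minus_left)
  moreover have "(- z) powi (r - 2 * m) * (- z) powi (2 * m) = (- z) powi r"
    using assms by (subst power_int_add[symmetric]) auto
  ultimately have z_part:
    "(- z) powi (r - 2 * m) * (- (z\<^sup>2)) powi m = (-1) powi m * (- z) powi r"
    by (simp only: mult.left_commute)
  have "q powi binom2 (r - 2 * m) * (- z) powi (r - 2 * m) * (q powi m\<^sup>2 * (- (z\<^sup>2)) powi m)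
    = (q powi binom2 (r - 2 * m) * q powi m\<^sup>2) * ((- z) powi (r - 2 * m) * (- (z\<^sup>2)) powi m)"
    by (simp only: mult_ac)
  then show ?thesis
    unfolding q_part z_part by (simp only: mult_ac)
qed

lemma has_sum_theta_product:
  assumes q: "norm q < 1" "q \<noteq> 0" and z: "z \<noteq> 0"
  shows "((\<lambda>r. q powi binom2 r * (- z) powi r * quintuple_coeff q r) has_sum
    (qpoch_inf z q * qpoch_inf (q / z) q * qpoch_inf q q) *
    (qpoch_inf (q * z\<^sup>2) (q\<^sup>2) * qpoch_inf (q / z\<^sup>2) (q\<^sup>2) * qpoch_inf (q\<^sup>2) (q\<^sup>2))) UNIV"
    (is "(_ has_sum ?U * ?V) _")
proof -
  let ?u = "\<lambda>n. q powi binom2 n * (- z) powi n"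
  let ?v = "\<lambda>m. q powi m\<^sup>2 * (- (z\<^sup>2)) powi m"
  let ?w = "\<lambda>r m. (-1) powi m * q powi (3 * m\<^sup>2 - (2 * r - 1) * m)"
  have "(?u has_sum ?U) UNIV" "(?v has_sum ?V) UNIV"
    using q z by (auto intro: jacobi_triple_product jacobi_triple_product_square)
  then have "((\<lambda>(n, m). ?u n * ?v m) has_sum ?U * ?V) (UNIV \<times> UNIV)"
    by (rule has_sum_Times_mult)
  also have "?this \<longleftrightarrow> ((\<lambda>(r, m). ?u r * ?w r m) has_sum ?U * ?V) (UNIV \<times> UNIV)"
    by (rule has_sum_reindex_bij_witness
          [of _ "\<lambda>(r, m). (r - 2 * m, m)" "\<lambda>(n, m). (n + 2 * m, m)"])
       (auto simp flip: theta_product_diagonal[OF q(2) z])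
  finally show ?thesis
    by (rule has_sum_SigmaD)
       (auto intro!: has_sum_cmult_right has_sum_quintuple_coeff q simp: mult.assoc)
qed

theorem quintuple_product:
  fixes q z :: complex
  assumes q: "norm q < 1" "q \<noteq> 0" and z: "z \<noteq> 0"
  shows "((\<lambda>r. (-1) powi (r mod 3) * (q powi (r * (r - 1) div 6) * z powi r)) has_sum
    qpoch_inf z q * qpoch_inf (q / z) q * qpoch_inf q q *
    (qpoch_inf (q * z\<^sup>2) (q\<^sup>2) * qpoch_inf (q / z\<^sup>2) (q\<^sup>2))) {r::int. r mod 3 \<noteq> 2}"
    (is "(?t has_sum ?S) _")
proof -
  let ?D = "qpoch_inf (q\<^sup>2) (q\<^sup>2)"
  have D_nonzero: "?D \<noteq> 0"
    using q by (intro qpoch_inf_nonzero) (auto simp: norm_power power_less_one_iff)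
  have term_eq: "q powi binom2 r * (- z) powi r * quintuple_coeff q r = ?t r * ?D"
    if "r mod 3 \<noteq> 2" for r
  proof -
    define e where "e = r * (r - 1) div 6"
    have "binom2 r + - 2 * e = e"
      using six_mult_pred_div_six[OF that, folded e_def] two_mult_binom2[of r] by simp
    then have q_part: "q powi binom2 r * q powi (- 2 * e) = q powi e"
      using q by (simp flip: power_int_add)
    have z_part: "(- z) powi r * (-1) powi (r + r mod 3) = (-1) powi (r mod 3) * z powi r"
      by (simp add: power_int_minus_left)
    have "q powi binom2 r * (- z) powi r * quintuple_coeff q r
        = (q powi binom2 r * q powi (- 2 * e)) * ((- z) powi r * (-1) powi (r + r mod 3)) * ?D"
      unfolding quintuple_coeff_eq[OF q that] e_def by (simp only: mult_ac)
    also have "\<dots> = ?t r * ?D"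
      unfolding q_part z_part unfolding e_def by (simp only: mult_ac)
    finally show ?thesis .
  qed
  have "((\<lambda>r. q powi binom2 r * (- z) powi r * quintuple_coeff q r) has_sum ?S * ?D) UNIV"
    using has_sum_theta_product[OF assms] by (simp add: mult_ac)
  also have "?this \<longleftrightarrow> ((\<lambda>r. ?t r * ?D) has_sum ?S * ?D) {r. r mod 3 \<noteq> 2}"
    by (rule has_sum_cong_neutral) (auto simp: quintuple_coeff_eq_0 q term_eq)
  finally show ?thesis
    using D_nonzero by (simp add: has_sum_cmult_left_iff)
qed

definition quintuple_exponent :: "int \<Rightarrow> int \<Rightarrow> int \<Rightarrow> int" where
  "quintuple_exponent m k r = m * (r * (r - 1) div 6) + k * r"

lemma quintuple_exponent_square:
  assumes "r mod 3 \<noteq> 2"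
  shows "24 * m * quintuple_exponent m k r + (6 * k - m)\<^sup>2 = (2 * m * r + 6 * k - m)\<^sup>2"
proof -
  have "24 * m * quintuple_exponent m k r = 4 * m\<^sup>2 * (6 * (r * (r - 1) div 6)) + 24 * m * k * r"
    by (simp add: quintuple_exponent_def power2_eq_square distrib_left)
  also have "6 * (r * (r - 1) div 6) = r * (r - 1)"
    using assms by (rule six_mult_pred_div_six)
  finally show ?thesis
    by (simp add: power2_eq_square algebra_simps)
qed

corollary quintuple_product_powers:
  fixes q :: complex
  assumes q: "norm q < 1" "q \<noteq> 0" and "m > 0" "2 * k \<le> m"
  shows "((\<lambda>r. (-1) powi (r mod 3) * q powi quintuple_exponent (int m) (int k) r) has_sum
    qpochs_inf [q ^ k, q ^ (m - k), q ^ m] (q ^ m)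
      * qpochs_inf [q ^ (m + 2 * k), q ^ (m - 2 * k)] (q ^ (2 * m)))
    {r. r mod 3 \<noteq> 2}"
proof -
  have "(q ^ m) powi (r * (r - 1) div 6) * (q ^ k) powi r
      = q powi quintuple_exponent (int m) (int k) r" for r
    using q by (simp add: quintuple_exponent_def power_int_power power_int_add)
  moreover have "q ^ m / q ^ k = q ^ (m - k)" "q ^ m * (q ^ k)\<^sup>2 = q ^ (m + 2 * k)"
    "q ^ m / (q ^ k)\<^sup>2 = q ^ (m - 2 * k)" "(q ^ m)\<^sup>2 = q ^ (2 * m)"
    using assms by (simp_all add: power_diff power_add power_mult mult.commute[of 2] flip: power_mult)
  moreover have "norm (q ^ m) < 1" "q ^ m \<noteq> 0" "q ^ k \<noteq> 0"
    using assms by (simp_all add: norm_power power_less_one_iff)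
  ultimately show ?thesis
    using quintuple_product[of "q ^ m" "q ^ k"] by (simp add: qpochs_inf_def mult_ac)
qed

section \<open>Odd parts\<close>

lemma qpoch_inf_self_factor:
  assumes "norm x < 1"
  shows "qpoch_inf x x = qpochs_inf [x\<^sup>2, x ^ 3, x ^ 5] (x ^ 5) * qpochs_inf [x ^ 9, x] (x ^ 10)
    * qpochs_inf [x ^ 4, x ^ 6] (x ^ 10)"
proof -
  have norm_x5: "norm (x ^ 5) < 1"
    using assms by (simp add: norm_power power_less_one_iff)
  have "qpoch_inf x x = qpoch_inf x (x ^ 5) * qpoch_inf (x\<^sup>2) (x ^ 5) * qpoch_inf (x ^ 3) (x ^ 5)
      * qpoch_inf (x ^ 4) (x ^ 5) * qpoch_inf (x ^ 5) (x ^ 5)"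
    by (subst qpoch_inf_split[OF assms, of 5]) (simp_all add: eval_nat_numeral mult_ac)
  also have "qpoch_inf x (x ^ 5) = qpoch_inf x (x ^ 10) * qpoch_inf (x ^ 6) (x ^ 10)"
    by (subst qpoch_inf_split[OF norm_x5, of 2])
       (simp_all add: numeral_2_eq_2 flip: power_mult power_Suc)
  also have "qpoch_inf (x ^ 4) (x ^ 5) = qpoch_inf (x ^ 4) (x ^ 10) * qpoch_inf (x ^ 9) (x ^ 10)"
    by (subst qpoch_inf_split[OF norm_x5, of 2])
       (simp_all add: numeral_2_eq_2 flip: power_mult power_add)
  finally show ?thesis
    by (simp add: qpochs_inf_def mult_ac)
qed

lemma quintuple_product_5_2:
  fixes x :: complex
  assumes x: "norm x < 1" "x \<noteq> 0" and q: "q = x\<^sup>2"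
  shows "((\<lambda>r. (-1) powi (r mod 3) * x powi quintuple_exponent 5 2 r) has_sum
    qpoch_inf x x / qpochs_inf [q\<^sup>2, q ^ 3] (q ^ 5)) {r. r mod 3 \<noteq> 2}"
proof -
  have "norm (x ^ k) < 1" if "k > 0" for k
    using x that by (simp add: norm_power power_less_one_iff)
  then have "qpochs_inf [q\<^sup>2, q ^ 3] (q ^ 5) \<noteq> 0"
    by (simp add: q qpochs_inf_def qpoch_inf_nonzero flip: power_mult)
  then show ?thesis
    using quintuple_product_powers[OF x, of 5 2] qpoch_inf_self_factor[OF x(1)]
    by (simp add: q flip: power_mult)
qed

lemma pentagonal_eq_odd:
  assumes "(6 * n + 1)\<^sup>2 = (8 * r + 5)\<^sup>2" "r mod 3 \<noteq> 2"
  shows "pentagonal n = 2 * quintuple_exponent 8 3 r + 1"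
  using assms(1) two_mult_pentagonal[of n] quintuple_exponent_square[OF assms(2), of 8 3]
  by (simp add: power2_eq_square algebra_simps)

lemma odd_pentagonal_cases:
  assumes "odd (pentagonal n)"
  obtains s where "n = - 4 * s - 1" | s where "n = 4 * s + 2"
proof -
  define s where "s = n div 4"
  have "n \<noteq> 4 * s"
  proof
    assume "n = 4 * s"
    then have "pentagonal n = 2 * (s * (12 * s + 1))"
      using two_mult_pentagonal[of n] by simp
    with assms show False by simp
  qed
  moreover have "n \<noteq> 4 * s + 1"
  proof
    assume "n = 4 * s + 1"
    then have "pentagonal n = 2 * ((4 * s + 1) * (3 * s + 1))"
      using two_mult_pentagonal[of n] by (simp add: algebra_simps)
    with assms show False by simp
  qed
  ultimately have "n = - 4 * (- s - 1) - 1 \<or> n = 4 * s + 2"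
    unfolding s_def by presburger
  then show ?thesis using that by blast
qed

definition pentagonal_index :: "int \<Rightarrow> int" where
  "pentagonal_index r = (if 3 dvd r then - 4 * (r div 3) - 1 else 4 * (r div 3) + 2)"

lemma pentagonal_index_simps [simp]:
  "pentagonal_index (3 * s) = - 4 * s - 1" "pentagonal_index (3 * s + 1) = 4 * s + 2"
proof -
  have "\<not> 3 dvd 3 * s + 1" "(3 * s + 1) div 3 = s"
    by presburger+
  then show "pentagonal_index (3 * s) = - 4 * s - 1" "pentagonal_index (3 * s + 1) = 4 * s + 2"
    by (simp_all add: pentagonal_index_def)
qed

lemma square_pentagonal_index:
  assumes "r mod 3 \<noteq> 2"
  shows "(6 * pentagonal_index r + 1)\<^sup>2 = (8 * r + 5)\<^sup>2"
proof -
  have "6 * pentagonal_index r + 1 = - (8 * r + 5) \<or> 6 * pentagonal_index r + 1 = 8 * r + 5"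
    using assms by (cases rule: mod_3_neq_2_cases) simp_all
  then show ?thesis
    by (metis power2_minus)
qed

lemma bij_betw_pentagonal_index:
  "bij_betw pentagonal_index {r. r mod 3 \<noteq> 2} {n. odd (pentagonal n)}"
proof (rule bij_betw_imageI)
  show "inj_on pentagonal_index {r. r mod 3 \<noteq> 2}"
  proof (rule inj_onI)
    fix r r'
    assume "r \<in> {r. r mod 3 \<noteq> 2}" "r' \<in> {r. r mod 3 \<noteq> 2}"
      and "pentagonal_index r = pentagonal_index r'"
    then have "(8 * r + 5)\<^sup>2 = (8 * r' + 5)\<^sup>2"
      by (simp flip: square_pentagonal_index)
    then show "r = r'"
      unfolding power2_eq_iff by presburger
  qed
  have "pentagonal_index r \<in> {n. odd (pentagonal n)}" if "r mod 3 \<noteq> 2" for r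
    using pentagonal_eq_odd[OF square_pentagonal_index[OF that] that] by simp
  moreover have "n \<in> pentagonal_index ` {r. r mod 3 \<noteq> 2}" if "odd (pentagonal n)" for n
    using that
  proof (cases rule: odd_pentagonal_cases)
    case (1 s)
    then have "n = pentagonal_index (3 * s)" by simp
    moreover have "3 * s mod 3 \<noteq> 2" by simp
    ultimately show ?thesis by blast
  next
    case (2 s)
    then have "n = pentagonal_index (3 * s + 1)" by simp
    moreover have "(3 * s + 1) mod 3 \<noteq> 2" by presburger
    ultimately show ?thesis by blast
  qed
  ultimately show "pentagonal_index ` {r. r mod 3 \<noteq> 2} = {n. odd (pentagonal n)}"
    by auto
qed

lemma qpoch_inf_self_odd_part:
  fixes x :: complex
  assumes x: "norm x < 1" "x \<noteq> 0" and q: "q = x\<^sup>2"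
  shows "(qpoch_inf x x - qpoch_inf (- x) (- x)) / 2
    = - x * (qpochs_inf [q ^ 3, q ^ 5, q ^ 8] (q ^ 8) * qpochs_inf [q ^ 2, q ^ 14] (q ^ 16))"
    (is "?L = - x * ?R")
proof -
  let ?e = "quintuple_exponent 8 3"
  let ?t = "\<lambda>n. (-1) powi n * x powi pentagonal n"
  have term_eq: "?t (pentagonal_index r) = - x * ((-1) powi (r mod 3) * q powi ?e r)"
    if "r mod 3 \<noteq> 2" for r
  proof -
    have "(-1 :: complex) powi pentagonal_index r = - ((-1) powi (r mod 3))"
      using that by (cases rule: mod_3_neq_2_cases) (simp_all add: power_int_minus_left)
    moreover have "x powi (2 * ?e r + 1) = x * q powi ?e r"
      using x by (simp add: q power_int_add power_int_mult)
    ultimately show ?thesis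
      unfolding pentagonal_eq_odd[OF square_pentagonal_index[OF that] that] by simp
  qed
  have "(?t has_sum ?L) {n. odd (pentagonal n)}"
    using has_sum_odd_part[OF pentagonal_number_theorem[OF x] pentagonal_number_theorem[of "- x"]] x
    by simp
  also have "?this \<longleftrightarrow> ((\<lambda>r. ?t (pentagonal_index r)) has_sum ?L) {r. r mod 3 \<noteq> 2}"
    by (rule has_sum_reindex_bij_betw[OF bij_betw_pentagonal_index, symmetric])
  also have "\<dots> \<longleftrightarrow> ((\<lambda>r. - x * ((-1) powi (r mod 3) * q powi ?e r)) has_sum ?L) {r. r mod 3 \<noteq> 2}"
    by (intro has_sum_cong term_eq) simp
  finally have "((\<lambda>r. - x * ((-1) powi (r mod 3) * q powi ?e r)) has_sum ?L) {r. r mod 3 \<noteq> 2}" .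
  moreover have "((\<lambda>r. - x * ((-1) powi (r mod 3) * q powi ?e r)) has_sum - x * ?R) {r. r mod 3 \<noteq> 2}"
  proof (rule has_sum_cmult_right)
    have "norm q < 1" "q \<noteq> 0"
      using x by (auto simp: q norm_power power_less_one_iff)
    then show "((\<lambda>r. (-1) powi (r mod 3) * q powi ?e r) has_sum ?R) {r. r mod 3 \<noteq> 2}"
      using quintuple_product_powers[of q 8 3] by (simp add: qpochs_inf_def mult_ac)
  qed
  ultimately show ?thesis
    by (rule has_sum_unique)
qed

section \<open>Enumerating the squares\<close>

lemma enumerate_range:
  fixes f :: "nat \<Rightarrow> 'a::wellorder"
  assumes "strict_mono f"
  shows "enumerate (range f) n = f n"
proof (induction n)
  case 0
  show ?case
    unfolding enumerate_0 using assms
    by (intro Least_equality) (auto simp: strict_mono_less_eq)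
next
  case (Suc n)
  have "infinite (range f)"
    using assms by (intro range_inj_infinite strict_mono_imp_inj_on)
  then have "enumerate (range f) (Suc n) = (LEAST y. y \<in> range f \<and> f n < y)"
    by (simp add: enumerate_Suc'' Suc.IH)
  also have "\<dots> = f (Suc n)"
    using assms by (intro Least_equality) (auto simp: strict_mono_less strict_mono_less_eq)
  finally show ?case .
qed

definition periodic_seq :: "nat \<Rightarrow> nat list \<Rightarrow> nat \<Rightarrow> nat" where
  "periodic_seq p rs n = p * (n div length rs) + rs ! (n mod length rs)"

lemma strict_mono_periodic_seq:
  assumes "rs \<noteq> []" "sorted_wrt (<) rs" "set rs \<subseteq> {..<p}"
  shows "strict_mono (periodic_seq p rs)"
proof (rule strict_monoI_Suc)
  fix n
  let ?l = "length rs"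
  have "n mod ?l < ?l"
    using assms(1) by simp
  then have less_p: "rs ! (n mod ?l) < p"
    using assms(3) nth_mem by blast
  show "periodic_seq p rs n < periodic_seq p rs (Suc n)"
  proof (cases "Suc (n mod ?l) = ?l")
    case True
    then show ?thesis
      using less_p by (simp add: periodic_seq_def div_Suc mod_Suc)
  next
    case False
    then have "Suc (n mod ?l) < ?l"
      using \<open>n mod ?l < ?l\<close> by simp
    then show ?thesis
      using assms(2) False by (simp add: periodic_seq_def div_Suc mod_Suc sorted_wrt_nth_less)
  qed
qed

lemma range_periodic_seq:
  assumes "rs \<noteq> []" "set rs \<subseteq> {..<p}"
  shows "range (periodic_seq p rs) = {k. k mod p \<in> set rs}"
proof (intro equalityI subsetI)
  fix k assume "k \<in> range (periodic_seq p rs)"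
  then obtain n where "k = periodic_seq p rs n" by blast
  moreover have "rs ! (n mod length rs) \<in> set rs"
    using assms(1) by simp
  ultimately show "k \<in> {k. k mod p \<in> set rs}"
    using assms(2) by (auto simp: periodic_seq_def)
next
  fix k assume "k \<in> {k. k mod p \<in> set rs}"
  then obtain i where "i < length rs" "rs ! i = k mod p"
    by (auto simp: in_set_conv_nth)
  then have "k = periodic_seq p rs (length rs * (k div p) + i)"
    using assms(1) by (simp add: periodic_seq_def)
  then show "k \<in> range (periodic_seq p rs)" by blast
qed

definition root_residues :: "nat list" where
  "root_residues = [13, 37, 43, 53, 67, 77, 83, 107]"

definition root_seq :: "nat \<Rightarrow> nat" where
  "root_seq = periodic_seq 120 root_residues"

lemma square_mod_240_eq_169_iff:
  fixes k :: nat
  shows "k\<^sup>2 mod 240 = 169 \<longleftrightarrow> k mod 120 \<in> set root_residues"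
proof -
  define t r where "t = k div 120" and "r = k mod 120"
  have "k = 120 * t + r"
    by (simp add: t_def r_def)
  then have "k\<^sup>2 = 240 * (60 * t\<^sup>2 + t * r) + r\<^sup>2"
    by (simp add: power2_eq_square algebra_simps)
  then have square_mod: "k\<^sup>2 mod 240 = r\<^sup>2 mod 240"
    by (simp only: mod_mult_self4)
  have residues: "root_residues = filter (\<lambda>r. r\<^sup>2 mod 240 = 169) [0..<120]"
  proof -
    have "[0..<120] = 0 # 1 # [2..<120]"
      by (simp add: upt_conv_Cons[of 0] upt_conv_Cons[of "Suc 0"] numeral_2_eq_2)
    then show ?thesis
      by (simp add: root_residues_def)
  qed
  show ?thesis
    unfolding square_mod residues set_filter set_upt by (simp add: r_def)
qed

lemma strict_mono_root_seq: "strict_mono root_seq"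
  unfolding root_seq_def root_residues_def by (rule strict_mono_periodic_seq) auto

lemma range_root_seq: "range root_seq = {k. k\<^sup>2 mod 240 = 169}"
  unfolding root_seq_def square_mod_240_eq_169_iff
  by (rule range_periodic_seq) (auto simp: root_residues_def)

lemma root_seq_square: "240 * (((root_seq n)\<^sup>2 - 169) div 240) + 169 = (root_seq n)\<^sup>2"
proof -
  have "(root_seq n)\<^sup>2 mod 240 = 169"
    using range_root_seq by blast
  then have "240 dvd (root_seq n)\<^sup>2 - 169" "169 \<le> (root_seq n)\<^sup>2"
    using dvd_minus_mod mod_less_eq_dividend by metis+
  then show ?thesis by simp
qed

lemma a_seq_eq: "a_seq n = ((root_seq n)\<^sup>2 - 169) div 240"
proof -
  define b where "b n = ((root_seq n)\<^sup>2 - 169) div 240" for n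
  have b_square: "240 * b n + 169 = (root_seq n)\<^sup>2" for n
    unfolding b_def by (rule root_seq_square)
  have "strict_mono b"
  proof (rule strict_monoI)
    fix m n :: nat
    assume "m < n"
    then have "(root_seq m)\<^sup>2 < (root_seq n)\<^sup>2"
      using strict_mono_root_seq by (intro power_strict_mono) (auto dest: strict_monoD)
    then show "b m < b n"
      by (simp flip: b_square)
  qed
  moreover have "square_idx = range b"
  proof (intro equalityI subsetI)
    fix m assume "m \<in> square_idx"
    then obtain k where k_square: "240 * m + 169 = k\<^sup>2"
      by (auto simp: square_idx_def)
    then have "k\<^sup>2 mod 240 = 169"
      by (simp flip: k_square)
    then obtain n where "k = root_seq n"
      using range_root_seq by blast
    then have "m = b n"
      using k_square b_square[of n] by simp
    then show "m \<in> range b" by blast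
  qed (use b_square in \<open>auto simp: square_idx_def\<close>)
  ultimately have "enumerate square_idx n = b n"
    using enumerate_range by metis
  then show ?thesis
    by (simp add: a_seq_def b_def)
qed

definition root_sign :: "nat \<Rightarrow> complex" where
  "root_sign k = (if k mod 30 \<in> {13, 17} then 1 else -1)"

lemma root_sign_root_seq: "root_sign (root_seq n) = (-1) ^ nat \<lfloor>5 * real n / 4\<rfloor>"
proof -
  define t i where "t = n div 8" and "i = n mod 8"
  have n_eq: "n = 8 * t + i" and i_range: "i \<in> {0, 1, 2, 3, 4, 5, 6, 7}"
    by (auto simp: t_def i_def)
  have "nat \<lfloor>5 * real n / 4\<rfloor> = 5 * n div 4"
    using floor_divide_of_nat_eq[of "5 * n" 4, where ?'a = real] by simp
  also have "\<dots> = 2 * (5 * t) + 5 * i div 4"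
    using i_range unfolding n_eq by auto
  finally have "(-1 :: complex) ^ nat \<lfloor>5 * real n / 4\<rfloor> = (-1) ^ (5 * i div 4)"
    by (simp add: power_add power_mult)
  moreover have "root_seq n mod 30 = root_residues ! i mod 30"
  proof -
    have "root_seq n = 30 * (4 * t) + root_residues ! i"
      by (simp add: root_seq_def periodic_seq_def t_def i_def root_residues_def)
    then show ?thesis
      by (simp only: mod_mult_self4)
  qed
  ultimately show ?thesis
    using i_range by (auto simp: root_sign_def root_residues_def)
qed

lemma root_mod_240_imp_mod_30:
  fixes k :: nat
  assumes "k\<^sup>2 mod 240 = 169"
  shows "k mod 30 \<in> {7, 13, 17, 23}"
proof -
  have "k mod 30 = k mod 120 mod 30"
    by (simp add: mod_mod_cancel)
  then show ?thesis
    using assms by (auto simp: square_mod_240_eq_169_iff root_residues_def)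
qed

lemma root_mod_240E:
  fixes k :: nat
  assumes "k\<^sup>2 mod 240 = 169"
  obtains r where "k = nat \<bar>10 * r + 7\<bar>" "r mod 3 \<noteq> 2"
proof -
  define t where "t = k div 30"
  have "k = 30 * t + k mod 30"
    by (simp add: t_def)
  then consider "k = 30 * t + 7" | "k = 30 * t + 13" | "k = 30 * t + 17" | "k = 30 * t + 23"
    using root_mod_240_imp_mod_30[OF assms] by auto
  then show ?thesis
  proof cases
    case 1
    then show ?thesis by (intro that[of "3 * int t"]) simp_all
  next
    case 2
    then show ?thesis by (intro that[of "- 3 * int t - 2"]) (simp, presburger)
  next
    case 3
    then show ?thesis by (intro that[of "3 * int t + 1"]) (simp, presburger)
  next
    case 4
    then show ?thesis by (intro that[of "- 3 * int t - 3"]) (simp, presburger)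
  qed
qed

lemma bij_betw_square_root:
  "bij_betw (\<lambda>r. nat \<bar>10 * r + 7\<bar>)
    {r. r mod 3 \<noteq> 2 \<and> odd (quintuple_exponent 5 2 r)} {k. k\<^sup>2 mod 240 = 169}"
    (is "bij_betw ?k {r. _ \<and> odd (?e r)} _")
proof -
  have odd_iff: "odd (?e r) \<longleftrightarrow> (?k r)\<^sup>2 mod 240 = 169" if "r mod 3 \<noteq> 2" for r
  proof -
    have "int ((?k r)\<^sup>2 mod 240) = (120 * ?e r + 49) mod 240"
      using quintuple_exponent_square[OF that, of 5 2] by (simp add: zmod_int add.commute)
    moreover have "(120 * e + 49) mod 240 = 169 \<longleftrightarrow> odd e" for e :: int
      by (cases "even e") (auto elim!: evenE oddE simp: distrib_left)
    ultimately have "int ((?k r)\<^sup>2 mod 240) = int 169 \<longleftrightarrow> odd (?e r)"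
      by (simp only: of_nat_numeral)
    then show ?thesis
      by (simp only: of_nat_eq_iff)
  qed
  show ?thesis
  proof (rule bij_betw_imageI)
    show "inj_on ?k {r. r mod 3 \<noteq> 2 \<and> odd (?e r)}"
    proof (rule inj_onI)
      fix r r' assume "?k r = ?k r'"
      then have "10 * r + 7 = 10 * r' + 7 \<or> 10 * r + 7 = - (10 * r' + 7)"
        by (simp add: eq_nat_nat_iff abs_eq_iff)
      then show "r = r'" by presburger
    qed
    show "?k ` {r. r mod 3 \<noteq> 2 \<and> odd (?e r)} = {k. k\<^sup>2 mod 240 = 169}"
      using odd_iff root_mod_240E by blast
  qed
qed

lemma root_sign_square_root:
  assumes "r mod 3 \<noteq> 2"
  shows "root_sign (nat \<bar>10 * r + 7\<bar>) = - ((-1) powi (r mod 3))"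
  using assms
proof (cases rule: mod_3_neq_2_cases)
  case (1 s)
  then have "nat \<bar>10 * r + 7\<bar> = (if s \<ge> 0 then 30 * nat s + 7 else 30 * nat (- s - 1) + 23)"
    by simp arith
  then have "nat \<bar>10 * r + 7\<bar> mod 30 \<in> {7, 23}"
    by simp
  then show ?thesis
    using 1 by (auto simp: root_sign_def)
next
  case (2 s)
  then have "nat \<bar>10 * r + 7\<bar> = (if s \<ge> 0 then 30 * nat s + 17 else 30 * nat (- s - 1) + 13)"
    by simp arith
  then have "nat \<bar>10 * r + 7\<bar> mod 30 \<in> {13, 17}"
    by simp
  moreover have "r mod 3 = 1"
    using 2 by presburger
  ultimately show ?thesis
    by (auto simp: root_sign_def)
qed

lemma square_root_term_eq:
  fixes x :: complex and r :: int
  assumes x: "x \<noteq> 0" "q = x\<^sup>2"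
    and r: "r mod 3 \<noteq> 2" "odd (quintuple_exponent 5 2 r)"
  defines "k \<equiv> nat \<bar>10 * r + 7\<bar>"
  shows "root_sign k * q ^ ((k\<^sup>2 - 169) div 240) =
    - 1 / x * ((-1) powi (r mod 3) * x powi quintuple_exponent 5 2 r)"
proof -
  from r(2) obtain m where exponent: "quintuple_exponent 5 2 r = 2 * m + 1"
    by (rule oddE)
  have int_square: "int (k\<^sup>2) = 240 * m + 169"
    using quintuple_exponent_square[OF r(1), of 5 2] unfolding exponent
    by (simp add: k_def add.commute)
  moreover have "0 \<le> int (k\<^sup>2)"
    by simp
  ultimately have "m \<ge> 0"
    by linarith
  moreover from this int_square have "k\<^sup>2 = 240 * nat m + 169"
    by linarith
  ultimately have "q ^ ((k\<^sup>2 - 169) div 240) = q powi m"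
    by (simp add: power_int_nonneg_exp)
  also have "\<dots> = x powi (2 * m + 1) / x"
    using x by (simp add: power_int_add power_int_mult)
  finally show ?thesis
    unfolding exponent k_def root_sign_square_root[OF r(1)] by simp
qed

lemma has_sum_square_roots:
  assumes q: "norm q < 1" "q \<noteq> 0"
  shows "((\<lambda>k. root_sign k * q ^ ((k\<^sup>2 - 169) div 240)) has_sum
    qpochs_inf [q ^ 3, q ^ 5, q ^ 8] (q ^ 8) * qpochs_inf [q ^ 2, q ^ 14] (q ^ 16)
      / qpochs_inf [q ^ 2, q ^ 3] (q ^ 5)) {k. k\<^sup>2 mod 240 = 169}"
    (is "(?f has_sum ?R / ?H) _")
proof -
  let ?e = "quintuple_exponent 5 2"
  define x where "x = csqrt q"
  have q_eq: "q = x\<^sup>2"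
    by (simp add: x_def)
  then have x: "norm x < 1" "x \<noteq> 0"
    using q by (auto simp: norm_power power_less_one_iff)
  have "((\<lambda>r. (-1) powi (r mod 3) * x powi ?e r) has_sum
      (qpoch_inf x x / ?H - qpoch_inf (- x) (- x) / ?H) / 2) {r \<in> {r. r mod 3 \<noteq> 2}. odd (?e r)}"
    using x by (intro has_sum_odd_part quintuple_product_5_2) (auto simp: q_eq)
  also have "(qpoch_inf x x / ?H - qpoch_inf (- x) (- x) / ?H) / 2
      = (qpoch_inf x x - qpoch_inf (- x) (- x)) / 2 / ?H"
    by (simp only: diff_divide_distrib divide_divide_eq_left mult.commute)
  also have "\<dots> = - x * ?R / ?H"
    unfolding qpoch_inf_self_odd_part[OF x q_eq] ..
  finally have "((\<lambda>r. - 1 / x * ((-1) powi (r mod 3) * x powi ?e r)) has_sum - 1 / x * (- x * ?R / ?H))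
      {r. r mod 3 \<noteq> 2 \<and> odd (?e r)}"
    by (intro has_sum_cmult_right) simp
  also have "- 1 / x * (- x * ?R / ?H) = ?R / ?H"
    using x by simp
  also have "((\<lambda>r. - 1 / x * ((-1) powi (r mod 3) * x powi ?e r)) has_sum ?R / ?H)
        {r. r mod 3 \<noteq> 2 \<and> odd (?e r)}
      \<longleftrightarrow> ((\<lambda>r. ?f (nat \<bar>10 * r + 7\<bar>)) has_sum ?R / ?H) {r. r mod 3 \<noteq> 2 \<and> odd (?e r)}"
    by (intro has_sum_cong square_root_term_eq[OF x(2) q_eq, symmetric]) auto
  also have "\<dots> \<longleftrightarrow> ?thesis"
    by (rule has_sum_reindex_bij_betw[OF bij_betw_square_root])
  finally show ?thesis .
qed

theorem theorem10:
  fixes q :: complex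
  assumes "norm q < 1"
  shows "(\<lambda>n. (-1) ^ nat \<lfloor>5 * real n / 4\<rfloor> * q ^ a_seq n) sums
    (qpochs_inf [q ^ 3, q ^ 5, q ^ 8] (q ^ 8) * qpochs_inf [q ^ 2, q ^ 14] (q ^ 16)
      / qpochs_inf [q ^ 2, q ^ 3] (q ^ 5))"
proof (cases "q = 0")
  case True
  have "a_seq 0 = 0"
    by (simp add: a_seq_eq root_seq_def periodic_seq_def root_residues_def)
  then have "a_seq n = 0 \<longleftrightarrow> n = 0" for n
    using strict_mono_a_seq by (metis strict_mono_eq)
  then have "(\<lambda>n. (-1) ^ nat \<lfloor>5 * real n / 4\<rfloor> * q ^ a_seq n) = (\<lambda>n. if n = 0 then 1 else 0)"
    by (auto simp: True fun_eq_iff power_0_left)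
  then show ?thesis
    using sums_single[of 0 "\<lambda>_. 1 :: complex"] by (simp add: True qpochs_inf_def qpoch_inf_def)
next
  case False
  have "bij_betw root_seq UNIV {k. k\<^sup>2 mod 240 = 169}"
    using strict_mono_root_seq range_root_seq by (simp add: bij_betw_def strict_mono_imp_inj_on)
  from has_sum_imp_sums[OF iffD2[OF has_sum_reindex_bij_betw[OF this] has_sum_square_roots[OF assms False]]]
  show ?thesis
    by (simp only: a_seq_eq root_sign_root_seq)
qed

end
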